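(* A hypergraph $\mathcal{H}=([n],\mathcal{E})$ has the unique parent-child property if and only if it is in hyperfect elimination order.
   Context: $[n]=\{1,\ldots,n\}$. A hypergraph $\mathcal{H}=([n],\mathcal{E})$ has $\mathcal{E}\subseteq2^{[n]}$ with all hyperedges nonempty. For $i\le n$, $\mathcal{H}_i$ is the subgraph induced by $[i]$, i.e. the hypergraph on $[i]$ whose hyperedges are those $A\in\mathcal{E}$ with $A\subseteq[i]$. $X-n$ means $X\setminus\{n\}$. Hyperfect elimination order. $\mathcal{H}=([n],\mathcal{E})$ is in hyperfect elimination order if either $n=0$, or $n\ge1$ and: (i) for any two (not necessarily distinct) hyperedges $A,B\in\mathcal{E}$ with $n\in A\cap B$ and any two distinct vertices $a\in A-n$, $b\in B-n$ there is $X\in\mathcal{E}$ with $\{a,b\}\subseteq X\subseteq(A\cup B)-n$; and (ii) $\mathcal{H}_{n-1}$ is in hyperfect elimination order. Orientations. An orientation of $\mathcal{H}$ is a map $h:\mathcal{E}\to[n]$ with $h(A)\in A$ for all $A\in\mathcal{E}$. It is acyclic if the digraph on $[n]$ with an arc $i\to j$ for all distinct $i,j$ such that $i,j\in A$ and $j=h(A)$ for some $A\in\mathcal{E}$ is acyclic. $\mathrm{AO}_{\mathcal{H}}$ is the set of acyclic orientations. For $h\in\mathrm{AO}_{\mathcal{H}}$, $P_{\mathcal{H},h}$ is the poset on $[n]$ given by the transitive closure of: $i\prec j$ if $i\neq j$ and there is $A\in\mathcal{E}$ with $i,j\in A$ and $j=h(A)$. Unique parent-child property. $\mathcal{H}=([n],\mathcal{E})$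 has the unique parent-child property if either $n=0$, or $n\ge1$ and: (i) for every $h\in\mathrm{AO}_{\mathcal{H}}$ the vertex $n$ covers at most one element and is covered by at most one element in $P_{\mathcal{H},h}$; and (ii) $\mathcal{H}_{n-1}$ has the unique parent-child property. *)

theory Defs
  imports "HOL-Library.FuncSet"
begin

text \<open>A hypergraph on the vertex set \<open>{1..n}\<close> is given by \<open>n\<close> and its set \<open>E\<close> of hyperedges.\<close>

definition hypergraph :: "nat \<Rightarrow> nat set set \<Rightarrow> bool" where
  "hypergraph n E \<longleftrightarrow> E \<subseteq> Pow {1..n} \<and> {} \<notin> E"

definition induced :: "nat set set \<Rightarrow> nat \<Rightarrow> nat set set" where
  "induced E i = {A \<in> E. A \<subseteq> {1..i}}"

primrec hyperfect_elimination_order :: "nat \<Rightarrow> nat set set \<Rightarrow> bool" where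
  "hyperfect_elimination_order 0 E \<longleftrightarrow> True"
| "hyperfect_elimination_order (Suc m) E \<longleftrightarrow>
     (\<forall>A\<in>E. \<forall>B\<in>E. Suc m \<in> A \<inter> B \<longrightarrow>
        (\<forall>a \<in> A - {Suc m}. \<forall>b \<in> B - {Suc m}. a \<noteq> b \<longrightarrow>
           (\<exists>X\<in>E. {a, b} \<subseteq> X \<and> X \<subseteq> (A \<union> B) - {Suc m}))) \<and>
     hyperfect_elimination_order m (induced E m)"

text \<open>Orientations are maps with domain \<open>E\<close>; the extensional function space makes this
  precise for total HOL functions.\<close>

definition orientations :: "nat \<Rightarrow> nat set set \<Rightarrow> (nat set \<Rightarrow> nat) set" where
  "orientations n E = {h \<in> E \<rightarrow>\<^sub>E {1..n}. \<forall>A\<in>E. h A \<in> A}"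

definition orientation_arcs :: "nat set set \<Rightarrow> (nat set \<Rightarrow> nat) \<Rightarrow> (nat \<times> nat) set" where
  "orientation_arcs E h = {(i, j). i \<noteq> j \<and> (\<exists>A\<in>E. i \<in> A \<and> j \<in> A \<and> j = h A)}"

definition acyclic_orientations :: "nat \<Rightarrow> nat set set \<Rightarrow> (nat set \<Rightarrow> nat) set" where
  "acyclic_orientations n E = {h \<in> orientations n E. acyclic (orientation_arcs E h)}"

text \<open>The strict order of the poset attached to an acyclic orientation. For a hypergraph on
  \<open>{1..n}\<close> it is contained in \<open>{1..n} \<times> {1..n}\<close>, so the vertex set need not be mentioned here
  or in the cover relation.\<close>

definition orientation_order :: "nat set set \<Rightarrow> (nat set \<Rightarrow> nat) \<Rightarrow> (nat \<times> nat) set" where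
  "orientation_order E h = (orientation_arcs E h)\<^sup>+"

definition covers :: "(nat \<times> nat) set \<Rightarrow> nat \<Rightarrow> nat \<Rightarrow> bool" where
  "covers r y x \<longleftrightarrow> (x, y) \<in> r \<and> \<not> (\<exists>z. (x, z) \<in> r \<and> (z, y) \<in> r)"

primrec unique_parent_child :: "nat \<Rightarrow> nat set set \<Rightarrow> bool" where
  "unique_parent_child 0 E \<longleftrightarrow> True"
| "unique_parent_child (Suc m) E \<longleftrightarrow>
     (\<forall>h \<in> acyclic_orientations (Suc m) E.
        (\<exists>\<^sub>\<le>\<^sub>1 x. covers (orientation_order E h) (Suc m) x) \<and>
        (\<exists>\<^sub>\<le>\<^sub>1 y. covers (orientation_order E h) y (Suc m))) \<and>
     unique_parent_child m (induced E m)"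

end

theory Submission
  imports Defs
begin

text \<open>The two conditions are equivalent level by level. If \<open>n\<close> covers, or is covered by, two
  elements \<open>a \<noteq> b\<close>, then both relations are arcs coming from hyperedges \<open>A\<close>, \<open>B\<close>, and the head of
  the hyperedge \<open>X\<close> supplied by the elimination condition contradicts one of the two covers.
  Conversely, if no such \<open>X\<close> exists for \<open>A\<close>, \<open>B\<close>, \<open>a\<close>, \<open>b\<close>, orient every hyperedge towards its
  largest element in a linear order with
  \<open>(A \<union> B) - {a, b, n} < a < b < n < everything else\<close>; then \<open>n\<close> covers both \<open>a\<close> and \<open>b\<close>.\<close>

text \<open>A path with two or more arcs would place its last intermediate vertex strictly between
  \<open>x\<close> and \<open>y\<close>.\<close>

lemma covers_trancl_imp_arc:
  assumes "covers (R\<^sup>+) y x"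
  shows "(x, y) \<in> R"
  using assms unfolding covers_def by (meson r_into_trancl tranclE)

lemma orientation_arcsI:
  "A \<in> E \<Longrightarrow> i \<in> A \<Longrightarrow> h A \<in> A \<Longrightarrow> i \<noteq> h A \<Longrightarrow> (i, h A) \<in> orientation_arcs E h"
  unfolding orientation_arcs_def by blast

lemma orientation_orderI:
  "A \<in> E \<Longrightarrow> i \<in> A \<Longrightarrow> h A \<in> A \<Longrightarrow> i \<noteq> h A \<Longrightarrow> (i, h A) \<in> orientation_order E h"
  unfolding orientation_order_def by (blast intro: orientation_arcsI)

lemma orientation_order_trans:
  "(x, y) \<in> orientation_order E h \<Longrightarrow> (y, z) \<in> orientation_order E h \<Longrightarrow>
    (x, z) \<in> orientation_order E h"
  unfolding orientation_order_def by (rule trancl_trans)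

lemma covers_orientation_orderE:
  assumes "covers (orientation_order E h) y x"
  obtains A where "A \<in> E" "x \<in> A" "y \<in> A" "h A = y" "x \<noteq> y"
  using covers_trancl_imp_arc[OF assms[unfolded orientation_order_def]]
  unfolding orientation_arcs_def by blast

lemma acyclic_orientationsD:
  assumes "h \<in> acyclic_orientations n E"
  shows "A \<in> E \<Longrightarrow> h A \<in> A" "(x, x) \<notin> orientation_order E h"
  using assms unfolding acyclic_orientations_def orientations_def acyclic_def orientation_order_def
  by auto

text \<open>The first clause of the elimination order, freed from the recursion and stated at an
  arbitrary vertex.\<close>

definition eliminable :: "nat set set \<Rightarrow> nat \<Rightarrow> bool" where
  "eliminable E v \<longleftrightarrow> (\<forall>A\<in>E. \<forall>B\<in>E. v \<in> A \<inter> B \<longrightarrow>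
     (\<forall>a \<in> A - {v}. \<forall>b \<in> B - {v}. a \<noteq> b \<longrightarrow> (\<exists>X\<in>E. {a, b} \<subseteq> X \<and> X \<subseteq> (A \<union> B) - {v})))"

lemma eliminableE:
  assumes "eliminable E v" "A \<in> E" "B \<in> E" "v \<in> A" "v \<in> B"
    and "a \<in> A" "b \<in> B" "a \<noteq> v" "b \<noteq> v" "a \<noteq> b"
  obtains X where "X \<in> E" "a \<in> X" "b \<in> X" "X \<subseteq> (A \<union> B) - {v}"
proof -
  have "\<exists>X\<in>E. {a, b} \<subseteq> X \<and> X \<subseteq> (A \<union> B) - {v}"
    using assms(1)[unfolded eliminable_def, rule_format, of A B a b] assms(2-) by simp
  then show thesis
    using that by auto
qed

text \<open>Both hyperedges have head \<open>v\<close>, so \<open>h X\<close>, lying in one of them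
  and different from \<open>v\<close>, is below \<open>v\<close>. As \<open>x\<close> and
  \<open>y\<close> are distinct, at least one of them is strictly below \<open>h X\<close>, which
  then separates it from \<open>v\<close>.\<close>

lemma eliminable_covers_unique:
  assumes elim: "eliminable E v" and h: "h \<in> acyclic_orientations n E"
  shows "\<exists>\<^sub>\<le>\<^sub>1 x. covers (orientation_order E h) v x"
proof (rule Uniq_I, rule ccontr)
  fix x y
  assume x: "covers (orientation_order E h) v x" and y: "covers (orientation_order E h) v y"
    and "x \<noteq> y"
  obtain A where A: "A \<in> E" "x \<in> A" "v \<in> A" "h A = v" "x \<noteq> v"
    using x by (rule covers_orientation_orderE)
  obtain B where B: "B \<in> E" "y \<in> B" "v \<in> B" "h B = v" "y \<noteq> v"
    using y by (rule covers_orientation_orderE)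
  obtain X where X: "X \<in> E" "x \<in> X" "y \<in> X" "X \<subseteq> (A \<union> B) - {v}"
    using eliminableE[OF elim, of A B x y] A B \<open>x \<noteq> y\<close> by metis
  have hX: "h X \<in> X"
    using acyclic_orientationsD(1)[OF h] X(1) .
  then have "(h X, v) \<in> orientation_order E h"
    using X(4) A B orientation_orderI[of A E "h X" h] orientation_orderI[of B E "h X" h] by auto
  moreover have "x = h X \<or> (x, h X) \<in> orientation_order E h"
    and "y = h X \<or> (y, h X) \<in> orientation_order E h"
    using X hX orientation_orderI by blast+
  ultimately show False
    using x y \<open>x \<noteq> y\<close> unfolding covers_def by blast
qed

text \<open>Here the heads are \<open>x\<close> and \<open>y\<close>. The vertex \<open>h X\<close>
  is weakly above both and weakly below one of them, so it equals that one by acyclicity. Hence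
  \<open>x\<close> and \<open>y\<close> are comparable, and the smaller one separates
  \<open>v\<close> from the larger.\<close>

lemma eliminable_covered_unique:
  assumes elim: "eliminable E v" and h: "h \<in> acyclic_orientations n E"
  shows "\<exists>\<^sub>\<le>\<^sub>1 y. covers (orientation_order E h) y v"
proof (rule Uniq_I, rule ccontr)
  fix x y
  assume x: "covers (orientation_order E h) x v" and y: "covers (orientation_order E h) y v"
    and "x \<noteq> y"
  let ?lt = "\<lambda>i j. (i, j) \<in> orientation_order E h"
  obtain A where A: "A \<in> E" "v \<in> A" "x \<in> A" "h A = x" "v \<noteq> x"
    using x by (rule covers_orientation_orderE)
  obtain B where B: "B \<in> E" "v \<in> B" "y \<in> B" "h B = y" "v \<noteq> y"
    using y by (rule covers_orientation_orderE)
  obtain X where X: "X \<in> E" "x \<in> X" "y \<in> X" "X \<subseteq> (A \<union> B) - {v}"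
    using eliminableE[OF elim, of A B x y] A B \<open>x \<noteq> y\<close> by metis
  have hX: "h X \<in> X"
    using acyclic_orientationsD(1)[OF h] X(1) .
  have up: "x = h X \<or> ?lt x (h X)" "y = h X \<or> ?lt y (h X)"
    using X hX orientation_orderI by blast+
  have "h X = x \<or> ?lt (h X) x \<or> h X = y \<or> ?lt (h X) y"
    using hX X(4) A B orientation_orderI[of A E "h X" h] orientation_orderI[of B E "h X" h] by auto
  then have "h X = x \<or> h X = y"
    using up acyclic_orientationsD(2)[OF h] orientation_order_trans by blast
  then have "?lt x y \<or> ?lt y x"
    using up \<open>x \<noteq> y\<close> by metis
  then show False
    using x y unfolding covers_def by blast
qed

text \<open>The injective \<open>r\<close> encodes a linear order. Choosing the vertex of largest
  rank in each hyperedge makes every arc raise the rank strictly, which rules out cycles.\<close>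

lemma rank_orientation:
  fixes r :: "nat \<Rightarrow> nat"
  assumes hyp: "hypergraph n E" and inj: "inj r"
  obtains h where "h \<in> acyclic_orientations n E"
    and "\<And>A w. A \<in> E \<Longrightarrow> w \<in> A \<Longrightarrow> r w \<le> r (h A)"
    and "\<And>x y. (x, y) \<in> orientation_order E h \<Longrightarrow> r x < r y"
proof -
  have "\<forall>A\<in>E. \<exists>v. v \<in> A \<and> (\<forall>w\<in>A. r w \<le> r v)"
  proof
    fix A assume "A \<in> E"
    then have "finite A" "A \<noteq> {}"
      using hyp finite_subset[of A "{1..n}"] unfolding hypergraph_def by auto
    then have "Max (r ` A) \<in> r ` A" "\<forall>w\<in>A. r w \<le> Max (r ` A)"
      by auto
    then show "\<exists>v. v \<in> A \<and> (\<forall>w\<in>A. r w \<le> r v)"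
      by auto
  qed
  then obtain g where g: "\<And>A. A \<in> E \<Longrightarrow> g A \<in> A \<and> (\<forall>w\<in>A. r w \<le> r (g A))"
    by metis
  \<comment> \<open>Orientations are extensional, so values outside \<open>E\<close> must be
    \<open>undefined\<close>.\<close>
  define h where "h = restrict g E"
  have h: "h A \<in> A" "\<And>w. w \<in> A \<Longrightarrow> r w \<le> r (h A)" if "A \<in> E" for A
    using g that unfolding h_def by auto
  have arcs: "r x < r y" if "(x, y) \<in> orientation_arcs E h" for x y
    using that h(2) inj unfolding orientation_arcs_def
    by (auto simp: inj_eq order_less_le)
  have order: "r x < r y" if "(x, y) \<in> orientation_order E h" for x y
    using that unfolding orientation_order_def
    by (induction rule: trancl_induct) (auto dest: arcs)
  have "h \<in> orientations n E"
    using h(1) hyp unfolding orientations_def hypergraph_def h_def by fastforce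
  moreover have "acyclic (orientation_arcs E h)"
    using order unfolding acyclic_def orientation_order_def by blast
  ultimately show thesis
    using that h(2) order unfolding acyclic_orientations_def by blast
qed

lemma eliminable_if_covers_unique:
  assumes hyp: "hypergraph n E"
    and uniq: "\<And>h. h \<in> acyclic_orientations n E \<Longrightarrow>
      \<exists>\<^sub>\<le>\<^sub>1 x. covers (orientation_order E h) v x"
  shows "eliminable E v"
proof (rule ccontr)
  assume "\<not> eliminable E v"
  then obtain A B a b where AB: "A \<in> E" "B \<in> E" "v \<in> A" "v \<in> B"
    and ab: "a \<in> A" "b \<in> B" "a \<noteq> v" "b \<noteq> v" "a \<noteq> b"
    and noX: "\<not> (\<exists>X\<in>E. {a, b} \<subseteq> X \<and> X \<subseteq> (A \<union> B) - {v})"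
    unfolding eliminable_def Ball_def Int_iff Diff_iff singleton_iff by metis
  have bound: "x \<le> n" if "x \<in> A \<union> B" for x
  proof -
    have "A \<union> B \<subseteq> {1..n}"
      using AB(1,2) hyp unfolding hypergraph_def by blast
    then show ?thesis
      using that by auto
  qed
  \<comment> \<open>The other vertices of \<open>A \<union> B\<close> keep their own values, at most
    \<open>n\<close>; all vertices outside are shifted beyond \<open>n + 3\<close>.\<close>
  define r where "r x = (if x = a then n + 1 else if x = b then n + 2 else if x = v then n + 3
    else if x \<in> A \<union> B then x else x + n + 4)" for x
  have r_simps: "r a = n + 1" "r b = n + 2" "r v = n + 3"
    using ab by (auto simp: r_def)
  have r_le: "x \<in> A \<union> B" if "r x \<le> n + 3" for x
    using that ab AB by (auto simp: r_def split: if_splits)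
  have "inj r"
  proof (rule injI)
    fix x y assume "r x = r y"
    then show "x = y"
      using bound[of x] bound[of y] unfolding r_def by (simp split: if_splits)
  qed
  then obtain h where h: "h \<in> acyclic_orientations n E"
    and top: "\<And>A w. A \<in> E \<Longrightarrow> w \<in> A \<Longrightarrow> r w \<le> r (h A)"
    and order: "\<And>x y. (x, y) \<in> orientation_order E h \<Longrightarrow> r x < r y"
    using rank_orientation[OF hyp] by metis
  have head: "h C = v" if "C \<in> {A, B}" for C
  proof -
    have C: "C \<in> E" "v \<in> C" "h C \<in> A \<union> B"
      using that AB acyclic_orientationsD(1)[OF h] by auto
    then have "r (h C) \<le> n + 3"
      using bound[of "h C"] by (simp add: r_def)
    then show ?thesis
      using top[OF C(1,2)] \<open>inj r\<close> r_simps by (metis injD le_antisym)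
  qed
  have a_lt: "(a, v) \<in> orientation_order E h" and b_lt: "(b, v) \<in> orientation_order E h"
    using orientation_orderI[of A E a h] orientation_orderI[of B E b h] head AB ab by auto
  \<comment> \<open>A hyperedge with head \<open>b\<close> has only ranks up to
    \<open>n + 2\<close>, so it lies in \<open>A \<union> B\<close> without \<open>v\<close>. If it
    contained \<open>a\<close>, it would be the missing \<open>X\<close>.\<close>
  have not_arc: "(a, b) \<notin> orientation_arcs E h"
  proof
    assume "(a, b) \<in> orientation_arcs E h"
    then obtain X where X: "X \<in> E" "a \<in> X" "b \<in> X" "b = h X"
      unfolding orientation_arcs_def by blast
    have "w \<in> (A \<union> B) - {v}" if "w \<in> X" for w
    proof -
      have "r w \<le> n + 2"
        using top[OF X(1) that] X(4) r_simps by simp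
      then show ?thesis
        using r_le[of w] r_simps by auto
    qed
    then show False
      using noX X(1-3) by blast
  qed
  have not_lt: "(a, b) \<notin> orientation_order E h"
  proof
    assume "(a, b) \<in> orientation_order E h"
    \<comment> \<open>A longer path from \<open>a\<close> to \<open>b\<close> needs a rank strictly
      between \<open>n + 1\<close> and \<open>n + 2\<close>.\<close>
    then obtain c where "(a, c) \<in> orientation_order E h" "(c, b) \<in> orientation_order E h"
      using not_arc unfolding orientation_order_def by (meson r_into_trancl tranclE)
    then show False
      using order[of a c] order[of c b] r_simps by simp
  qed
  have "covers (orientation_order E h) v b"
    unfolding covers_def
  proof (intro conjI notI b_lt)
    assume "\<exists>z. (b, z) \<in> orientation_order E h \<and> (z, v) \<in> orientation_order E h"
    then obtain z where "(b, z) \<in> orientation_order E h" "(z, v) \<in> orientation_order E h"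
      by blast
    then show False
      using order[of b z] order[of z v] r_simps by simp
  qed
  \<comment> \<open>The only rank between those of \<open>a\<close> and \<open>v\<close> belongs to
    \<open>b\<close>, which is not above \<open>a\<close>.\<close>
  moreover have "covers (orientation_order E h) v a"
    unfolding covers_def
  proof (intro conjI notI a_lt)
    assume "\<exists>z. (a, z) \<in> orientation_order E h \<and> (z, v) \<in> orientation_order E h"
    then obtain z where z: "(a, z) \<in> orientation_order E h" "(z, v) \<in> orientation_order E h"
      by blast
    then have "r z = r b"
      using order[of a z] order[of z v] r_simps by simp
    then show False
      using \<open>inj r\<close> z(1) not_lt by (simp add: inj_eq)
  qed
  ultimately show False
    using uniq[OF h] \<open>a \<noteq> b\<close> by (auto dest: Uniq_D)
qed

theorem lemma10:
  fixes n :: nat and E :: "nat set set"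
  assumes "hypergraph n E"
  shows "unique_parent_child n E \<longleftrightarrow> hyperfect_elimination_order n E"
  using assms
proof (induction n arbitrary: E)
  case 0
  then show ?case by simp
next
  case (Suc m)
  have "hypergraph m (induced E m)"
    using Suc.prems unfolding hypergraph_def induced_def by auto
  \<comment> \<open>Both recursions descend to \<open>induced E m\<close>, so only the clauses at
    \<open>Suc m\<close> remain to be compared.\<close>
  moreover have "(\<forall>h \<in> acyclic_orientations (Suc m) E.
      (\<exists>\<^sub>\<le>\<^sub>1 x. covers (orientation_order E h) (Suc m) x) \<and>
      (\<exists>\<^sub>\<le>\<^sub>1 y. covers (orientation_order E h) y (Suc m))) \<longleftrightarrow> eliminable E (Suc m)"
    using eliminable_covers_unique eliminable_covered_unique
      eliminable_if_covers_unique[OF Suc.prems] by blast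
  ultimately show ?case
    using Suc.IH unfolding eliminable_def by simp
qed

end
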